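(* If $a$ is a $C^1$-smooth boundary point of a $\mathbb C$-convex domain $D\subset\mathbb C^n$, then $\partial D$ contains no non-trivial analytic disc through $a$ if and only if $L_a=\{0\}$.
   Context: A domain $D\subset\mathbb C^n$ is $\mathbb C$-convex if every non-empty intersection of $D$ with a complex (affine) line is a simply connected domain (in particular connected). A $C^1$-smooth boundary point $a$ is one near which $\partial D$ is a $C^1$ hypersurface, i.e. there is a $C^1$ function $r$ near $a$ with $dr(a)\neq0$ and $D=\{r<0\}$ near $a$. A non-trivial analytic disc in $\partial D$ through $a$ is a non-constant holomorphic map $\varphi:\mathbb D\to\mathbb C^n$ ($\mathbb D$ the unit disc) with $\varphi(\mathbb D)\subset\partial D$ and $\varphi(0)=a$. $L_a$ is the set of all vectors $X\in\mathbb C^n$ for which there exists $\varepsilon>0$ such that $\{a+\lambda X:\lambda\in\mathbb C,\ |\lambda|<\varepsilon\}\subset\partial D$. *)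

theory Defs
  imports "HOL-Complex_Analysis.Complex_Analysis"
begin

definition domain_Cn :: "(complex ^ 'n) set \<Rightarrow> bool" where
  "domain_Cn D \<longleftrightarrow> open D \<and> connected D \<and> D \<noteq> {}"

definition complex_line :: "(complex ^ 'n) set \<Rightarrow> bool" where
  "complex_line L \<longleftrightarrow> (\<exists>p v. v \<noteq> 0 \<and> L = {p + t *s v | t. True})"

(* The library's simply_connected includes path-connectedness, and the intersection
   of an open set with a line is automatically relatively open in that line. *)
definition C_convex :: "(complex ^ 'n) set \<Rightarrow> bool" where
  "C_convex D \<longleftrightarrow> domain_Cn D \<and>
     (\<forall>L. complex_line L \<longrightarrow> D \<inter> L \<noteq> {} \<longrightarrow> simply_connected (D \<inter> L))"

(* C1 is meant in the real sense, on the real vector space underlying C^n. *)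
definition C1_smooth_boundary_point :: "(complex ^ 'n) set \<Rightarrow> complex ^ 'n \<Rightarrow> bool" where
  "C1_smooth_boundary_point D a \<longleftrightarrow> a \<in> frontier D \<and>
     (\<exists>U (r :: complex ^ 'n \<Rightarrow> real) (r' :: complex ^ 'n \<Rightarrow> ((complex ^ 'n) \<Rightarrow>\<^sub>L real)).
        open U \<and> a \<in> U \<and>
        (\<forall>x\<in>U. (r has_derivative blinfun_apply (r' x)) (at x)) \<and>
        continuous_on U r' \<and> r' a \<noteq> 0 \<and>
        D \<inter> U = {x \<in> U. r x < 0})"

definition nontrivial_analytic_disc ::
    "(complex ^ 'n) set \<Rightarrow> complex ^ 'n \<Rightarrow> (complex \<Rightarrow> complex ^ 'n) \<Rightarrow> bool" where
  "nontrivial_analytic_disc S a \<phi> \<longleftrightarrow>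
     (\<forall>i. (\<lambda>z. \<phi> z $ i) holomorphic_on ball 0 1) \<and>
     \<not> \<phi> constant_on ball 0 1 \<and> \<phi> ` ball 0 1 \<subseteq> S \<and> \<phi> 0 = a"

definition L_set :: "(complex ^ 'n) set \<Rightarrow> complex ^ 'n \<Rightarrow> (complex ^ 'n) set" where
  "L_set D a = {X. \<exists>\<epsilon>>0. {a + t *s X | t. cmod t < \<epsilon>} \<subseteq> frontier D}"

end

theory Submission
  imports Defs
begin

text \<open>
  The complex tangent hyperplane at a smooth boundary point \<open>q\<close> misses \<open>D\<close>: otherwise all
  complex lines through \<open>q\<close> in some two-dimensional plane meet \<open>D\<close>, and comparing two families of
  points of \<open>D\<close> on these lines yields a continuous logarithm on a circle around \<open>0\<close>. By smoothness
  it follows that near \<open>a\<close> the tangent functional \<open>l\<^sub>q(\<cdot> - q)\<close> maps \<open>D\<close> into the plane slit along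
  \<open>[0, \<infinity>)\<close>, where a Harnack inequality is available.

  Let \<open>\<phi>(z) = a + z^m \<psi>(z)\<close> with \<open>X = \<psi>(0) \<noteq> 0\<close> be a disc in the boundary; the open mapping theorem
  makes it tangent at \<open>a\<close>, so \<open>l\<^sub>a(X) = 0\<close>. Push the disc into \<open>D\<close>, with new centre \<open>p\<close>. If \<open>q = p + u X\<close>
  is a boundary point, then the function \<open>l\<^sub>q(\<phi> - q)\<close> omits \<open>[0, \<infinity>)\<close>, has value \<open>-u l\<^sub>q(X)\<close> at \<open>0\<close> and
  \<open>m\<close>-th coefficient \<open>l\<^sub>q(X)\<close>; Harnack bounds \<open>\<bar>u\<bar>\<close> from below independently of the push. In the
  limit a disc in direction \<open>X\<close> lies in the closure of \<open>D\<close> and in the tangent hyperplane, hence in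
  the boundary.
\<close>

section \<open>Complex-linear functionals with given real part\<close>

text \<open>When \<open>f\<close> is the derivative of a defining function at a boundary point, the
  kernel of \<open>clin f\<close> is the direction space of the complex tangent hyperplane
  there.\<close>

definition clin :: "(complex ^ 'n \<Rightarrow> real) \<Rightarrow> complex ^ 'n \<Rightarrow> complex" where
  "clin f v = Complex (f v) (- f (\<i> *s v))"

lemma Re_clin [simp]: "Re (clin f v) = f v"
  by (simp add: clin_def)

lemma scaleR_eq_smult: "x *\<^sub>R (v :: complex ^ 'n) = complex_of_real x *s v"
  by (simp add: vec_eq_iff complex_eq_iff)

lemma norm_smult: "norm (c *s v) = cmod c * norm (v :: complex ^ 'n)"
  by (simp add: norm_vec_def norm_mult L2_set_right_distrib)

lemma clin_add:
  assumes "linear f" shows "clin f (u + v) = clin f u + clin f v"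
  by (simp add: clin_def complex_eq_iff linear_add[OF assms] vector_add_ldistrib)

lemma clin_smult:
  assumes "linear f" shows "clin f (c *s v) = c * clin f v"
proof -
  have c: "c *s v = Re c *\<^sub>R v + Im c *\<^sub>R (\<i> *s v)"
    by (simp add: vec_eq_iff complex_eq_iff)
  have ic: "\<i> *s (c *s v) = Re c *\<^sub>R (\<i> *s v) - Im c *\<^sub>R v"
    by (simp add: vec_eq_iff complex_eq_iff)
  have "f (c *s v) = Re c * f v + Im c * f (\<i> *s v)"
    by (simp add: c linear_add[OF assms] linear_scale[OF assms])
  moreover have "f (\<i> *s (c *s v)) = Re c * f (\<i> *s v) - Im c * f v"
    by (simp only: ic linear_diff[OF assms] linear_scale[OF assms] real_scaleR_def)
  ultimately show ?thesis
    by (simp add: clin_def complex_eq_iff)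
qed

lemma clin_diff:
  assumes "linear f" shows "clin f (u - v) = clin f u - clin f v"
  using clin_add[OF assms, of "u - v" v] by simp

lemma clin_0:
  assumes "linear f" shows "clin f 0 = 0"
  using clin_diff[OF assms, of 0 0] by simp

lemma clin_eq_sum:
  assumes "linear f" shows "clin f v = (\<Sum>i\<in>UNIV. v $ i * clin f (axis i 1))"
proof -
  have "clin f (\<Sum>i\<in>A. v $ i *s axis i 1) = (\<Sum>i\<in>A. v $ i * clin f (axis i 1))" if "finite A" for A
    using that by induction (simp_all add: clin_0 clin_add clin_smult assms)
  from this[of UNIV] show ?thesis
    by (simp add: basis_expansion)
qed

lemma norm_clin_le:
  "cmod (clin (blinfun_apply f) v) \<le> 2 * norm f * norm v"
proof -
  have "cmod (clin f v) \<le> \<bar>f v\<bar> + \<bar>f (\<i> *s v)\<bar>"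
    using cmod_le[of "clin f v"] by (simp add: clin_def)
  also have "\<dots> \<le> norm f * norm v + norm f * norm (\<i> *s v)"
    using norm_blinfun[of f v] norm_blinfun[of f "\<i> *s v"] by simp
  finally show ?thesis by (simp add: norm_smult mult_ac)
qed

lemma continuous_on_clin_blinfun [continuous_intros]:
  assumes "continuous_on S F" shows "continuous_on S (\<lambda>x. clin (blinfun_apply (F x)) v)"
  unfolding clin_def Complex_eq using assms by (intro continuous_intros)

lemma continuous_on_clin [continuous_intros]:
  assumes "linear f" "continuous_on S g" shows "continuous_on S (\<lambda>x. clin f (g x))"
  unfolding clin_eq_sum[OF assms(1), of "g _"] using assms by (intro continuous_intros)

lemma continuous_on_smult [continuous_intros]:
  fixes g :: "'a::topological_space \<Rightarrow> complex ^ 'n"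
  assumes "continuous_on S f" "continuous_on S g" shows "continuous_on S (\<lambda>x. f x *s g x)"
  unfolding vector_scalar_mult_def using assms by (intro continuous_intros)

section \<open>Complex tangent hyperplanes miss the domain\<close>

text \<open>Two logarithms of the same number differ by an integer multiple of
  \<open>2 * pi * \<i>\<close>, so \<open>k\<close> has discrete range on a connected set.\<close>

lemma continuous_logs_of_const:
  fixes k :: "'a::topological_space \<Rightarrow> complex"
  assumes "connected S" "continuous_on S k" "\<And>x. x \<in> S \<Longrightarrow> exp (k x) = c"
  shows "k constant_on S"
proof (rule continuous_discrete_range_constant[OF assms(1,2)])
  fix x assume x: "x \<in> S"
  have "2 * pi \<le> cmod (k y - k x)" if y: "y \<in> S" "k y \<noteq> k x" for y
  proof -
    obtain n :: int where n: "k y = k x + (of_int (2 * n) * pi) * \<i>"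
      using assms(3)[OF x] assms(3)[OF y(1)] by (metis exp_eq)
    with y(2) have "n \<noteq> 0" by auto
    then have "1 \<le> \<bar>real_of_int n\<bar>" by linarith
    with n show ?thesis by (simp add: norm_mult)
  qed
  then show "\<exists>e>0. \<forall>y. y \<in> S \<and> k y \<noteq> k x \<longrightarrow> e \<le> norm (k y - k x)"
    by (intro exI[of _ "2 * pi"]) auto
qed

text \<open>Along the parametrisation by the angle, adding \<open>\<i> * \<theta>\<close> turns
  \<open>g\<close> into a continuous logarithm of a constant, which must be constant. But
  \<open>g\<close> returns to its initial value after one turn, while the added term has grown by
  \<open>2 * pi * \<i>\<close>.\<close>

lemma no_continuous_log_on_circle:
  fixes g :: "complex \<Rightarrow> complex"
  assumes "R > 0" "continuous_on (sphere 0 R) g" "\<And>z. z \<in> sphere 0 R \<Longrightarrow> exp (g z) = c / z"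
  shows False
proof -
  define k where "k \<theta> = g (of_real R * cis \<theta>) + \<i> * of_real \<theta>" for \<theta>
  have "(\<lambda>\<theta>. of_real R * cis \<theta>) ` {0..2*pi} \<subseteq> sphere 0 R"
    using assms(1) by (auto simp: norm_mult)
  then have "continuous_on {0..2*pi} k"
    unfolding k_def
    by (intro continuous_intros continuous_on_compose2[OF assms(2)]) auto
  moreover have "exp (k \<theta>) = c / of_real R" for \<theta>
  proof -
    have "exp (k \<theta>) = (c / (of_real R * cis \<theta>)) * cis \<theta>"
      unfolding k_def exp_add using assms(1) assms(3)[of "of_real R * cis \<theta>"]
      by (simp add: norm_mult cis_conv_exp)
    then show ?thesis by simp
  qed
  ultimately have "k constant_on {0..2*pi}"
    by (intro continuous_logs_of_const) auto
  then have "k 0 = k (2*pi)"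
    unfolding constant_on_def by force
  then show False by (simp add: k_def)
qed

text \<open>
  On each fibre the identity has a continuous logarithm; the difference of its values at \<open>inverse s\<close>
  and at \<open>c\<close> does not depend on the choice of the logarithm and is therefore continuous in \<open>s\<close>.
\<close>

lemma no_simply_connected_fibres:
  fixes E :: "(complex \<times> complex) set"
  assumes E: "open E" and R: "R > 0" and c: "c \<noteq> 0"
    and sc: "\<And>s. s \<in> sphere 0 R \<Longrightarrow> simply_connected {t. (s, t) \<in> E}"
    and no0: "\<And>s. s \<in> sphere 0 R \<Longrightarrow> (s, 0) \<notin> E"
    and cE: "\<And>s. s \<in> sphere 0 R \<Longrightarrow> (s, c) \<in> E"
    and iE: "\<And>s. s \<in> sphere 0 R \<Longrightarrow> (s, inverse s) \<in> E"
  shows False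
proof -
  define F where "F s = {t. (s, t) \<in> E}" for s
  have opF: "open (F s)" for s
  proof -
    have "F s = (\<lambda>t. (s, t)) -` E" by (auto simp: F_def)
    then show ?thesis using E by (simp add: open_vimage continuous_on_Pair)
  qed
  have "\<exists>g. continuous_on (F s) g \<and> (\<forall>t\<in>F s. exp (g t) = t)" if s: "s \<in> sphere 0 R" for s
  proof -
    have "simply_connected (F s)" using sc s by (simp add: F_def)
    moreover have "\<forall>t\<in>F s. t \<noteq> 0" using no0[OF s] by (auto simp: F_def)
    ultimately show ?thesis
      using simply_connected_eq_continuous_log[OF opF, of s] continuous_on_id by metis
  qed
  then obtain g where g: "\<And>s. s \<in> sphere 0 R \<Longrightarrow> continuous_on (F s) (g s)"
      and eg: "\<And>s t. s \<in> sphere 0 R \<Longrightarrow> t \<in> F s \<Longrightarrow> exp (g s t) = t"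
    by metis
  define h where "h s = g s (inverse s) - g s c" for s
  have eh: "exp (h s) = inverse c / s" if "s \<in> sphere 0 R" for s
    using that eg cE iE by (simp add: h_def exp_diff F_def field_simps)
  have "continuous_on (sphere 0 R) h"
    unfolding continuous_on_eq_continuous_within
  proof
    fix s0 :: complex assume s0: "s0 \<in> sphere 0 R"
    then have s0n: "s0 \<noteq> 0" using R by auto
    have "connected (F s0)"
      using sc[OF s0] simply_connected_imp_connected by (auto simp: F_def)
    then have "path_connected (F s0)"
      using opF connected_open_path_connected by blast
    moreover have mem: "c \<in> F s0" "inverse s0 \<in> F s0"
      using cE iE s0 by (auto simp: F_def)
    ultimately obtain p where p: "path p" "path_image p \<subseteq> F s0" "pathstart p = c" "pathfinish p = inverse s0"
      unfolding path_connected_def by blast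
    obtain \<eta> where \<eta>: "\<eta> > 0" "cball (inverse s0) \<eta> \<subseteq> F s0"
      using mem(2) opF open_contains_cball by blast
    \<comment> \<open>The path joins the two parameters for \<open>s0\<close>, and the ball catches
      \<open>inverse s\<close> for nearby \<open>s\<close>. Compactness of \<open>K\<close> lets the
      tube lemma place it inside all nearby fibres.\<close>
    define K where "K = path_image p \<union> cball (inverse s0) \<eta>"
    have K: "compact K" "K \<subseteq> F s0"
      using p \<eta> by (auto simp: K_def compact_path_image)
    have "connected K" unfolding K_def
    proof (rule connected_Un)
      have "inverse s0 \<in> path_image p \<inter> cball (inverse s0) \<eta>"
        using p(4) \<eta>(1) pathfinish_in_path_image[of p] by auto
      then show "path_image p \<inter> cball (inverse s0) \<eta> \<noteq> {}" by blast
    qed (use p in \<open>auto simp: connected_path_image\<close>)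
    have "{s0} \<times> K \<subseteq> E" using K(2) by (auto simp: F_def)
    from Elementary_Topology.tube_lemma[OF K(1) E this] obtain V where V: "s0 \<in> V" "open V" "V \<times> K \<subseteq> E"
      by blast
    have hV: "h s = g s0 (inverse s) - g s0 c"
      if s: "s \<in> sphere 0 R" "s \<in> V" "inverse s \<in> cball (inverse s0) \<eta>" for s
    proof -
      have KF: "K \<subseteq> F s" using V(3) s(2) by (auto simp: F_def)
      \<comment> \<open>Both branches are logarithms of the identity on the connected set
        \<open>K\<close>, so they differ by a constant, and this constant cancels in
        \<open>h\<close>.\<close>
      have "(\<lambda>t. g s t - g s0 t) constant_on K"
      proof (rule continuous_logs_of_const[OF \<open>connected K\<close>])
        show "continuous_on K (\<lambda>t. g s t - g s0 t)"
          using g[OF s(1)] g[OF s0] KF K(2)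
          by (intro continuous_intros) (auto intro: continuous_on_subset)
        show "exp (g s t - g s0 t) = 1" if "t \<in> K" for t
        proof -
          have "t \<in> F s" "t \<in> F s0" using that KF K(2) by auto
          moreover then have "t \<noteq> 0" using no0[OF s0] by (auto simp: F_def)
          ultimately show ?thesis using eg s(1) s0 by (simp add: exp_diff)
        qed
      qed
      moreover have "c \<in> K" "inverse s \<in> K"
        using p(3) pathstart_in_path_image[of p] s(3) by (auto simp: K_def)
      ultimately have "g s (inverse s) - g s0 (inverse s) = g s c - g s0 c"
        unfolding constant_on_def by fastforce
      then show ?thesis by (simp add: h_def algebra_simps)
    qed
    have "isCont (g s0) (inverse s0)"
      using g[OF s0] opF mem(2) continuous_on_eq_continuous_at by blast
    then have "isCont (\<lambda>s. g s0 (inverse s) - g s0 c) s0"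
      using s0n by (intro continuous_intros isCont_o2[of s0 inverse "g s0"]) auto
    then have "continuous (at s0 within sphere 0 R) (\<lambda>s. g s0 (inverse s) - g s0 c)"
      using continuous_at_imp_continuous_at_within by blast
    moreover have "\<forall>\<^sub>F s in at s0 within sphere 0 R. g s0 (inverse s) - g s0 c = h s"
    proof -
      have "isCont inverse s0" using s0n by (intro continuous_intros) auto
      then have "\<forall>\<^sub>F s in at s0 within sphere 0 R. inverse s \<in> ball (inverse s0) \<eta>"
        using \<eta>(1) s0n by (intro topological_tendstoD) (auto intro!: tendsto_intros)
      moreover have "\<forall>\<^sub>F s in at s0 within sphere 0 R. s \<in> V"
        using V by (intro topological_tendstoD[OF tendsto_ident_at]) auto
      moreover have "\<forall>\<^sub>F s in at s0 within sphere 0 R. s \<in> sphere 0 R"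
        using eventually_at_filter by fastforce
      ultimately show ?thesis
        by eventually_elim (use hV in auto)
    qed
    moreover have "h s0 = g s0 (inverse s0) - g s0 c" by (simp add: h_def)
    ultimately show "continuous (at s0 within sphere 0 R) h"
      unfolding continuous_within by (auto intro: Lim_transform_eventually)
  qed
  then show False using no_continuous_log_on_circle[OF R _ eh] by blast
qed

text \<open>Since \<open>clin f v = 1\<close>, the functional recovers the parameter from the point,
  so the parametrisation is a homeomorphism onto the slice. The point \<open>t0\<close> only
  guarantees that the slice is non-empty.\<close>

lemma simply_connected_line_slice:
  fixes D :: "(complex ^ 'n) set"
  assumes D: "C_convex D" and l: "linear f" "clin f v = 1" and t0: "q + t0 *s v \<in> D"
  shows "simply_connected {t. q + t *s v \<in> D}"
proof -
  define L where "L = {q + t *s v | t. True}"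
  have v: "v \<noteq> 0" using l clin_0[of f] by auto
  then have "complex_line L" unfolding complex_line_def L_def by blast
  moreover have "D \<inter> L \<noteq> {}" using t0 by (auto simp: L_def)
  ultimately have sc: "simply_connected (D \<inter> L)" using D by (auto simp: C_convex_def)
  have "homeomorphism {t. q + t *s v \<in> D} (D \<inter> L) (\<lambda>t. q + t *s v) (\<lambda>z. clin f (z - q))"
    by (rule homeomorphismI)
      (auto simp: L_def clin_smult l intro!: continuous_intros)
  then show ?thesis
    using homeomorphic_simply_connected_eq homeomorphic_def sc by blast
qed

text \<open>The point \<open>q\<close> has parameter 0 on each line and lies outside
  \<open>D\<close>, so every slice is a simply connected set of nonzero numbers. One of the two
  parameters found in it is a fixed \<open>c\<close>, while the other, \<open>inverse s\<close>,
  winds once around 0 as \<open>s\<close> runs through the circle;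
  \<open>no_simply_connected_fibres\<close> excludes this.\<close>

lemma C_convex_avoids_complex_tangent:
  fixes D :: "(complex ^ 'n) set"
  assumes D: "C_convex D" and q: "q \<notin> D" "r q = (0::real)"
    and r: "(r has_derivative f) (at q)"
    and U: "open U" "q \<in> U" "D \<inter> U = {x \<in> U. r x < 0}"
    and \<nu>0: "clin f \<nu>0 \<noteq> 0" and X: "clin f X = 0"
  shows "q + X \<notin> D"
proof
  assume qX: "q + X \<in> D"
  have lin: "linear f" using r by (rule has_derivative_linear)
  note [simp] = clin_add[OF lin] clin_smult[OF lin] clin_diff[OF lin]
  have opD: "open D" using D by (auto simp: C_convex_def domain_Cn_def)
  define \<nu> where "\<nu> = inverse (clin f \<nu>0) *s \<nu>0"
  have \<nu>: "clin f \<nu> = 1" using \<nu>0 by (simp add: \<nu>_def)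
  \<comment> \<open>On the line through \<open>q\<close> in direction \<open>\<nu> + s *s X\<close> with \<open>\<bar>s\<bar> = R\<close> large, the parameter
    \<open>inverse s\<close> gives a point near \<open>q + X\<close>, and a small negative parameter one just inside \<open>D\<close> near \<open>q\<close>.\<close>
  define E where "E = {st. q + snd st *s (\<nu> + fst st *s X) \<in> D}"
  have opE: "open E"
  proof -
    have "E = (\<lambda>st. q + snd st *s (\<nu> + fst st *s X)) -` D" by (auto simp: E_def)
    then show ?thesis using opD by (auto intro!: open_vimage continuous_intros)
  qed
  have "\<exists>\<eta>>0. \<forall>\<tau>. cmod \<tau> < \<eta> \<longrightarrow> q + X + \<tau> *s \<nu> \<in> D"
  proof -
    have "open ((\<lambda>\<tau>. q + X + \<tau> *s \<nu>) -` D)"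
      using opD by (intro open_vimage continuous_intros)
    moreover have "0 \<in> (\<lambda>\<tau>. q + X + \<tau> *s \<nu>) -` D" using qX by simp
    ultimately obtain e where "e > 0" "ball 0 e \<subseteq> (\<lambda>\<tau>. q + X + \<tau> *s \<nu>) -` D"
      using open_contains_ball by blast
    then show ?thesis by (intro exI[of _ e]) auto
  qed
  then obtain \<eta> where \<eta>: "\<eta> > 0" "\<And>\<tau>. cmod \<tau> < \<eta> \<Longrightarrow> q + X + \<tau> *s \<nu> \<in> D" by blast
  \<comment> \<open>This makes \<open>inverse s\<close> have modulus \<open>\<eta> / 2\<close> on
    the circle.\<close>
  define R where "R = 2 / \<eta>"
  have R: "R > 0" using \<eta>(1) by (simp add: R_def)
  have iE: "(s, inverse s) \<in> E" if "s \<in> sphere 0 R" for s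
  proof -
    have s: "cmod s = R" using that by simp
    then have "s \<noteq> 0" using R by auto
    have "cmod (inverse s) < \<eta>" using s \<eta>(1) by (simp add: norm_inverse R_def)
    moreover have "q + inverse s *s (\<nu> + s *s X) = q + X + inverse s *s \<nu>"
      using \<open>s \<noteq> 0\<close> by (simp add: vector_add_ldistrib vector_smult_assoc add_ac)
    ultimately show ?thesis using \<eta>(2)[of "inverse s"]
      by (simp only: E_def mem_Collect_eq fst_conv snd_conv)
  qed
  define N where "N = norm \<nu> + R * norm X"
  have N: "N \<ge> 0" using R by (simp add: N_def)
  \<comment> \<open>\<open>N\<close> bounds the direction vectors on the whole circle. At distance
    at most \<open>\<delta> * N\<close> from \<open>q\<close> the remainder is then below
    \<open>\<delta>\<close>, while the linear part is exactly \<open>- \<delta>\<close>; so one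
    \<open>c\<close> serves all \<open>s\<close>.\<close>
  have "1 / (2 * (N + 1)) > 0" using N by simp
  then have "\<exists>d>0. \<forall>y. norm (y - q) < d \<longrightarrow>
      norm (r y - r q - f (y - q)) \<le> (1 / (2 * (N + 1))) * norm (y - q)"
    using r unfolding has_derivative_at_alt by blast
  then obtain d1 where d1: "d1 > 0" and
    dd: "\<And>y. norm (y - q) < d1 \<Longrightarrow> norm (r y - r q - f (y - q)) \<le> (1 / (2 * (N + 1))) * norm (y - q)"
    by blast
  obtain d2 where d2: "d2 > 0" "ball q d2 \<subseteq> U" using U open_contains_ball by blast
  define \<delta> where "\<delta> = min d1 d2 / (2 * (N + 1))"
  have \<delta>: "\<delta> > 0" "\<delta> * N < d1" "\<delta> * N < d2"
  proof -
    show "\<delta> > 0" using d1 d2 N by (simp add: \<delta>_def)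
    have "\<delta> * N < \<delta> * (2 * (N + 1))" using N \<open>\<delta> > 0\<close> by (intro mult_strict_left_mono) auto
    also have "\<dots> = min d1 d2" using N by (simp add: \<delta>_def)
    finally show "\<delta> * N < d1" "\<delta> * N < d2" by auto
  qed
  define c where "c = - complex_of_real \<delta>"
  have cE: "(s, c) \<in> E" if "s \<in> sphere 0 R" for s
  proof -
    define w where "w = \<nu> + s *s X"
    define y where "y = q + c *s w"
    have "norm w \<le> N"
      using that norm_triangle_ineq[of \<nu> "s *s X"] by (simp add: w_def N_def norm_smult)
    moreover have "norm (y - q) = \<delta> * norm w"
      using \<delta>(1) by (simp add: y_def norm_smult c_def)
    ultimately have yN: "norm (y - q) \<le> \<delta> * N" using \<delta>(1) by simp
    have "clin f w = 1" using X \<nu> by (simp add: w_def)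
    then have "clin f (y - q) = c" by (simp add: y_def)
    then have fy: "f (y - q) = - \<delta>" by (metis Re_clin c_def Re_complex_of_real uminus_complex.sel(1))
    have "norm (r y - r q - f (y - q)) \<le> (1 / (2 * (N + 1))) * norm (y - q)"
      using yN \<delta> by (intro dd) simp
    also have "\<dots> \<le> (1 / (2 * (N + 1))) * (\<delta> * N)"
      using yN N by (intro mult_left_mono) auto
    also have "\<dots> < \<delta>" using \<delta>(1) N by (simp add: field_simps add_nonneg_pos)
    finally have "r y < 0" using q(2) fy by simp
    moreover have "y \<in> U" using yN \<delta>(3) d2(2) by (auto simp: dist_norm norm_minus_commute)
    ultimately have "y \<in> D" using U(3) by blast
    then show ?thesis by (simp add: E_def y_def w_def)
  qed
  show False
  proof (rule no_simply_connected_fibres[OF opE R _ _ _ cE iE])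
    show "c \<noteq> 0" using \<delta>(1) by (simp add: c_def)
    show "simply_connected {t. (s, t) \<in> E}" if "s \<in> sphere 0 R" for s
    proof -
      have "clin f (\<nu> + s *s X) = 1" using \<nu> X by simp
      from simply_connected_line_slice[OF D lin this, of q c] cE[OF that]
      show ?thesis by (simp add: E_def)
    qed
    show "(s, 0) \<notin> E" for s using q(1) by (simp add: E_def)
  qed
qed

section \<open>Holomorphic preliminaries\<close>

text \<open>The function \<open>csqrt (- f z)\<close> takes values in the right half-plane. A Cayley
  transform sending its value at 0 to 0 makes it a self-map of the disc, and the Schwarz lemma at
  half the radius gives the factor 3, which squaring turns into 9.\<close>

lemma slit_plane_harnack:
  assumes r: "r > 0" and f: "f holomorphic_on ball 0 r"
    and slit: "\<And>z. z \<in> ball 0 r \<Longrightarrow> f z \<notin> \<real>\<^sub>\<ge>\<^sub>0" and z: "cmod z \<le> r / 2"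
  shows "cmod (f z) \<le> 9 * cmod (f 0)"
proof -
  define h where "h z = csqrt (- f z)" for z
  have slit': "- f z \<notin> \<real>\<^sub>\<le>\<^sub>0" if "z \<in> ball 0 r" for z
    using slit[OF that] by (auto simp: complex_nonpos_Reals_iff complex_nonneg_Reals_iff)
  have hh: "h holomorphic_on ball 0 r"
    unfolding h_def using f slit' by (intro holomorphic_intros) auto
  have Re_h: "Re (h z) > 0" if "z \<in> ball 0 r" for z
  proof (rule ccontr)
    assume "\<not> Re (h z) > 0"
    then have "Re (h z) = 0" using Re_csqrt[of "- f z"] by (simp add: h_def)
    then have "(h z)\<^sup>2 \<in> \<real>\<^sub>\<le>\<^sub>0"
      by (simp add: complex_nonpos_Reals_iff power2_eq_square)
    then show False using slit'[OF that] by (simp add: h_def)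
  qed
  have h2: "cmod (f z) = (cmod (h z))\<^sup>2" for z
    by (simp add: h_def flip: norm_power)
  define g where "g z = (h (of_real r * z) - h 0) / (h (of_real r * z) + cnj (h 0))" for z
  have mem: "of_real r * z \<in> ball 0 r" if "cmod z < 1" for z :: complex
    using that r by (simp add: norm_mult)
  have 0: "Re (h 0) > 0" using r by (intro Re_h) simp
  have den: "h (of_real r * z) + cnj (h 0) \<noteq> 0" if "cmod z < 1" for z
    using Re_h[OF mem[OF that]] 0 by (auto simp: complex_eq_iff)
  have hg: "g holomorphic_on ball 0 1"
    unfolding g_def
    by (intro holomorphic_intros holomorphic_on_compose_gen[OF _ hh, unfolded o_def]) (use mem den in auto)
  have g1: "cmod (g z) < 1" if "cmod z < 1" for z
  proof -
    define w where "w = h (of_real r * z)"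
    have w: "Re w > 0" unfolding w_def by (intro Re_h mem that)
    have "(cmod (w - h 0))\<^sup>2 < (cmod (w + cnj (h 0)))\<^sup>2"
      using mult_pos_pos[OF w 0] unfolding cmod_power2
      by (simp add: power2_eq_square algebra_simps)
    then have "cmod (w - h 0) < cmod (w + cnj (h 0))"
      by (simp add: power2_less_imp_less)
    then show ?thesis
      using den[OF that] by (simp add: g_def norm_divide flip: w_def)
  qed
  have g0: "g 0 = 0" by (simp add: g_def)
  define u where "u = z / of_real r"
  have u: "cmod u \<le> 1 / 2" using z r by (simp add: u_def norm_divide field_simps)
  have "cmod (g u) \<le> cmod u" by (rule Schwarz_Lemma(1)[OF hg g0 g1]) (use u in auto)
  with u have "cmod (g u) \<le> 1 / 2" by simp
  moreover have "of_real r * u = z" using r by (simp add: u_def)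
  ultimately have "cmod (h z - h 0) \<le> cmod (h z + cnj (h 0)) / 2"
    using den[of u] u by (simp add: g_def norm_divide field_simps)
  moreover have "cmod (h z + cnj (h 0)) \<le> cmod (h z) + cmod (h 0)"
    using norm_triangle_ineq[of "h z" "cnj (h 0)"] by simp
  moreover have "cmod (h z) - cmod (h 0) \<le> cmod (h z - h 0)" by (rule norm_triangle_ineq2)
  ultimately have "cmod (h z) \<le> 3 * cmod (h 0)" by simp
  then have "(cmod (h z))\<^sup>2 \<le> (3 * cmod (h 0))\<^sup>2" by (intro power_mono) auto
  then show ?thesis by (simp add: h2 power_mult_distrib)
qed

text \<open>The exponent is the least vanishing order among the non-constant components; a component
  attaining it keeps \<open>\<psi> 0\<close> nonzero. Thus \<open>\<psi> 0\<close> is a direction of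
  the disc even where its derivative vanishes.\<close>

lemma holomorphic_vector_factor:
  fixes \<phi> :: "complex \<Rightarrow> complex ^ 'n"
  assumes hol: "\<And>i. (\<lambda>z. \<phi> z $ i) holomorphic_on ball 0 R" and R: "R > 0"
    and nc: "\<not> \<phi> constant_on ball 0 R"
  obtains \<psi> :: "complex \<Rightarrow> complex ^ 'n" and m :: nat and s :: real where "0 < s" "s \<le> R" "0 < m" "\<And>i. (\<lambda>z. \<psi> z $ i) holomorphic_on ball 0 s"
    "\<And>z. z \<in> ball 0 s \<Longrightarrow> \<phi> z = \<phi> 0 + z ^ m *s \<psi> z" "\<psi> 0 \<noteq> 0"
proof -
  define I where "I = {i. \<not> (\<lambda>z. \<phi> z $ i) constant_on ball 0 R}"
  have const: "\<phi> z $ i = \<phi> 0 $ i" if "i \<notin> I" "z \<in> ball 0 R" for z i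
    using that R unfolding I_def constant_on_def by fastforce
  have "I \<noteq> {}"
  proof
    assume "I = {}"
    then have "\<phi> z = \<phi> 0" if "z \<in> ball 0 R" for z
      using const that by (simp add: vec_eq_iff)
    then show False using nc unfolding constant_on_def by blast
  qed
  \<comment> \<open>Order, radius and cofactor are packed together so that all three can be chosen
    at once for each component.\<close>
  define P where "P i n s g \<longleftrightarrow> 0 < n \<and> 0 < s \<and> s \<le> R \<and> g holomorphic_on ball 0 s \<and>
          (\<forall>w\<in>ball 0 s. \<phi> w $ i = \<phi> 0 $ i + w ^ n * g w \<and> g w \<noteq> 0)"
    for i :: 'n and n :: nat and s :: real and g :: "complex \<Rightarrow> complex"
  have "\<exists>n s g. P i n s g" if i: "i \<in> I" for i
  proof -
    have h: "(\<lambda>z. \<phi> z $ i - \<phi> 0 $ i) holomorphic_on ball 0 R"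
      using hol by (intro holomorphic_intros)
    have nc: "\<not> (\<lambda>z. \<phi> z $ i - \<phi> 0 $ i) constant_on ball 0 R"
      using i unfolding I_def constant_on_def by (auto simp: diff_eq_eq)
    obtain g s n where g: "0 < n" "0 < s" "ball 0 s \<subseteq> ball (0::complex) R" "g holomorphic_on ball 0 s"
      "\<And>w. w \<in> ball 0 s \<Longrightarrow> \<phi> w $ i - \<phi> 0 $ i = (w - 0) ^ n * g w"
      "\<And>w. w \<in> ball 0 s \<Longrightarrow> g w \<noteq> 0"
    proof (rule holomorphic_factor_zero_nonconstant[OF h open_ball connected_ball _ _ nc])
      show "0 \<in> ball (0::complex) R" "\<phi> 0 $ i - \<phi> 0 $ i = 0" using R by auto
    qed blast
    have "s \<le> R" using g(2,3) by (simp add: ball_subset_ball_iff)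
    moreover have "\<phi> w $ i = \<phi> 0 $ i + w ^ n * g w" if "w \<in> ball 0 s" for w
      using g(5)[OF that] by (metis add.commute diff_add_cancel diff_zero)
    ultimately show ?thesis unfolding P_def using g(1,2,4,6) by blast
  qed
  then obtain n s g where "\<And>i. i \<in> I \<Longrightarrow> P i (n i) (s i) (g i)"
    by metis
  then have n: "\<And>i. i \<in> I \<Longrightarrow> 0 < n i" and s: "\<And>i. i \<in> I \<Longrightarrow> 0 < s i"
    "\<And>i. i \<in> I \<Longrightarrow> s i \<le> R" and g: "\<And>i. i \<in> I \<Longrightarrow> g i holomorphic_on ball 0 (s i)"
    "\<And>i w. i \<in> I \<Longrightarrow> w \<in> ball 0 (s i) \<Longrightarrow> \<phi> w $ i = \<phi> 0 $ i + w ^ n i * g i w"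
    "\<And>i w. i \<in> I \<Longrightarrow> w \<in> ball 0 (s i) \<Longrightarrow> g i w \<noteq> 0"
    unfolding P_def by blast+
  define m where "m = Min (n ` I)"
  define s0 where "s0 = Min (s ` I)"
  have fin: "finite I" by simp
  have m: "\<And>i. i \<in> I \<Longrightarrow> m \<le> n i" using fin by (simp add: m_def)
  obtain i0 where i0: "i0 \<in> I" "n i0 = m"
    using Min_in[of "n ` I"] \<open>I \<noteq> {}\<close> fin unfolding m_def by fastforce
  have s0: "s0 \<le> s i" if "i \<in> I" for i using that fin by (simp add: s0_def)
  have s0p: "s0 > 0" using s(1) \<open>I \<noteq> {}\<close> fin by (simp add: s0_def)
  have s0R: "s0 \<le> R" using s0 s(2) i0(1) by (meson order_trans)
  \<comment> \<open>The natural subtraction is exact because \<open>m\<close> is the minimum of the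
    orders; constant components contribute 0.\<close>
  define \<psi> :: "complex \<Rightarrow> complex ^ 'n" where "\<psi> z = (\<chi> i. if i \<in> I then z ^ (n i - m) * g i z else 0)" for z
  show thesis
  proof (rule that[of s0 m \<psi>])
    show "0 < s0" "s0 \<le> R" "0 < m" using s0p s0R n i0 by auto
    show "(\<lambda>z. \<psi> z $ i) holomorphic_on ball 0 s0" for i
    proof (cases "i \<in> I")
      case True
      have "g i holomorphic_on ball 0 s0"
        using s0[OF True] by (intro holomorphic_on_subset[OF g(1)[OF True]]) auto
      then show ?thesis using True by (simp add: \<psi>_def) (intro holomorphic_intros)
    qed (simp add: \<psi>_def)
    show "\<phi> z = \<phi> 0 + z ^ m *s \<psi> z" if z: "z \<in> ball 0 s0" for z
    proof -
      have "\<phi> z $ i = \<phi> 0 $ i + z ^ m * \<psi> z $ i" for i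
      proof (cases "i \<in> I")
        case True
        have "z \<in> ball 0 (s i)" using z s0[OF True] by auto
        then have "\<phi> z $ i = \<phi> 0 $ i + z ^ (m + (n i - m)) * g i z"
          using g(2)[OF True] m[OF True] by simp
        then show ?thesis using True by (simp add: \<psi>_def power_add mult.assoc)
      next
        case False
        then show ?thesis using const[OF False, of z] z s0R by (simp add: \<psi>_def)
      qed
      then show ?thesis by (simp add: vec_eq_iff)
    qed
    have "\<psi> 0 $ i0 = g i0 0" using i0 by (simp add: \<psi>_def)
    then show "\<psi> 0 \<noteq> 0" using g(3)[OF i0(1), of 0] s(1)[OF i0(1)] by auto
  qed
qed

section \<open>The domain near a smooth boundary point\<close>

text \<open>On one ball all the functionals \<open>clin (r' x)\<close> are uniformly bounded and
  take values close to 1 at a common vector \<open>\<nu>\<close>. This makes \<open>\<nu>\<close>,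
  rescaled at any point of the ball, transversal at all the others.\<close>

locale boundary_chart =
  fixes D :: "(complex ^ 'n) set" and a :: "complex ^ 'n" and r :: "complex ^ 'n \<Rightarrow> real"
    and r' :: "complex ^ 'n \<Rightarrow> (complex ^ 'n) \<Rightarrow>\<^sub>L real" and \<nu> :: "complex ^ 'n" and \<rho> M :: real
  assumes C_convex: "C_convex D" and a: "a \<in> frontier D" and \<rho>: "\<rho> > 0" and M: "M > 0"
    and deriv: "x \<in> ball a \<rho> \<Longrightarrow> (r has_derivative blinfun_apply (r' x)) (at x)"
    and D_iff: "x \<in> ball a \<rho> \<Longrightarrow> x \<in> D \<longleftrightarrow> r x < 0"
    and near_1: "x \<in> ball a \<rho> \<Longrightarrow> cmod (clin (r' x) \<nu> - 1) \<le> 1 / 4"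
    and bound: "x \<in> ball a \<rho> \<Longrightarrow> cmod (clin (r' x) v) \<le> M * norm v"

text \<open>A direction on which \<open>r' a\<close> does not vanish is rescaled to give
  \<open>\<nu>\<close> the value 1 at \<open>a\<close>; continuity of \<open>r'\<close> spreads this
  normalisation and the norm bound to a ball.\<close>

lemma boundary_chart_exists:
  fixes D :: "(complex ^ 'n) set"
  assumes D: "C_convex D" and "C1_smooth_boundary_point D a"
  obtains r r' \<nu> \<rho> M where "boundary_chart D a r r' \<nu> \<rho> M"
proof -
  from assms(2) obtain U and r :: "complex ^ 'n \<Rightarrow> real" and r' where a: "a \<in> frontier D" and U: "open U" "a \<in> U"
    and r: "\<forall>x\<in>U. (r has_derivative blinfun_apply (r' x)) (at x)"
    and r': "continuous_on U r'" "r' a \<noteq> 0" and DU: "D \<inter> U = {x \<in> U. r x < 0}"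
    unfolding C1_smooth_boundary_point_def by blast
  obtain v where v: "blinfun_apply (r' a) v \<noteq> 0"
    using r'(2) by (metis blinfun_eqI zero_blinfun.rep_eq)
  then have v0: "clin (r' a) v \<noteq> 0" by (metis Re_clin zero_complex.sel(1))
  define \<nu> where "\<nu> = inverse (clin (r' a) v) *s v"
  have lin: "linear (blinfun_apply f)" for f :: "(complex ^ 'n) \<Rightarrow>\<^sub>L real"
    by (rule bounded_linear.linear[OF blinfun.bounded_linear_right])
  have \<nu>: "clin (r' a) \<nu> = 1" using v0 by (simp add: \<nu>_def clin_smult[OF lin])
  have "continuous_on U (\<lambda>x. clin (r' x) \<nu>)" using r'(1) by (intro continuous_intros)
  then have "isCont (\<lambda>x. clin (r' x) \<nu>) a" using U continuous_on_eq_continuous_at by blast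
  then obtain d1 where d1: "d1 > 0" "\<And>x. dist x a < d1 \<Longrightarrow> dist (clin (r' x) \<nu>) 1 < 1 / 4"
    unfolding continuous_at_eps_delta \<nu> by (metis zero_less_divide_1_iff zero_less_numeral)
  have "isCont r' a" using r' U continuous_on_eq_continuous_at by blast
  then obtain d2 where d2: "d2 > 0" "\<And>x. dist x a < d2 \<Longrightarrow> dist (r' x) (r' a) < 1"
    unfolding continuous_at_eps_delta by (metis zero_less_one)
  obtain d3 where d3: "d3 > 0" "ball a d3 \<subseteq> U" using U open_contains_ball by blast
  define \<rho> where "\<rho> = min d1 (min d2 d3)"
  define M where "M = 2 * (norm (r' a) + 1)"
  show thesis
  proof (rule that[of r r' \<nu> \<rho> M], unfold_locales)
    show "0 < \<rho>" "0 < M" using d1 d2 d3 by (auto simp: \<rho>_def M_def add_nonneg_pos)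
    fix x assume x: "x \<in> ball a \<rho>"
    then have xU: "x \<in> U" using d3 by (auto simp: \<rho>_def)
    then show "(r has_derivative blinfun_apply (r' x)) (at x)" using r by blast
    show "x \<in> D \<longleftrightarrow> r x < 0" using DU xU by blast
    show "cmod (clin (r' x) \<nu> - 1) \<le> 1 / 4"
      using d1(2)[of x] x by (simp add: \<rho>_def dist_norm norm_minus_commute)
    fix v :: "complex ^ 'n"
    have "norm (r' x) \<le> norm (r' a) + 1"
      using d2(2)[of x] x norm_triangle_ineq2[of "r' x" "r' a"]
      by (simp add: \<rho>_def dist_norm norm_minus_commute)
    then have "2 * norm (r' x) * norm v \<le> M * norm v"
      unfolding M_def by (intro mult_right_mono) auto
    then show "cmod (clin (r' x) v) \<le> M * norm v"
      using norm_clin_le[of "r' x" v] by simp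
  qed (use D a in auto)
qed

context boundary_chart
begin

lemma linear_r' [simp]: "linear (blinfun_apply (r' q))"
  by (rule bounded_linear.linear[OF blinfun.bounded_linear_right])

lemma open_D: "open D"
  using C_convex by (simp add: C_convex_def domain_Cn_def)

text \<open>The part of the ball where \<open>r\<close> is positive is open and misses
  \<open>D\<close>, hence also misses the closure of \<open>D\<close>.\<close>

lemma r_nonpos:
  assumes "z \<in> closure D" "z \<in> ball a \<rho>" shows "r z \<le> 0"
proof (rule ccontr)
  assume "\<not> r z \<le> 0"
  moreover have "continuous_on (ball a \<rho>) r"
    using deriv by (intro continuous_at_imp_continuous_on ballI has_derivative_continuous)
  then have "open (ball a \<rho> \<inter> r -` {0<..})"
    by (intro continuous_open_preimage) auto
  ultimately have "D \<inter> (ball a \<rho> \<inter> r -` {0<..}) \<noteq> {}"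
    using assms open_Int_closure_eq_empty[of "ball a \<rho> \<inter> r -` {0<..}" D] by auto
  then show False using D_iff by fastforce
qed

lemma r_frontier:
  assumes "q \<in> frontier D" "q \<in> ball a \<rho>" shows "r q = 0" "q \<notin> D"
proof -
  show "q \<notin> D" using assms(1) open_D by (simp add: frontier_def interior_open)
  then show "r q = 0" using D_iff[OF assms(2)] r_nonpos[OF _ assms(2)] assms(1)
    by (simp add: frontier_def)
qed

lemma clin_\<nu>_nz: "x \<in> ball a \<rho> \<Longrightarrow> clin (r' x) \<nu> \<noteq> 0"
  using near_1[of x] by auto

lemma complex_tangent_avoids:
  assumes "q \<in> frontier D" "q \<in> ball a \<rho>" "clin (r' q) X = 0"
  shows "q + X \<notin> D"
  using assms D_iff
  by (intro C_convex_avoids_complex_tangent[OF C_convex r_frontier(2,1) deriv open_ball[of a \<rho>] _ _ clin_\<nu>_nz]) auto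

section \<open>Descent of the defining function in transversal directions\<close>

lemma r_descends:
  assumes w: "\<And>x. x \<in> ball a \<rho> \<Longrightarrow> r' x w > 0" and z: "z \<in> ball a \<rho>"
    and s: "s > 0" "z - s *\<^sub>R w \<in> ball a \<rho>"
  shows "r (z - s *\<^sub>R w) < r z"
proof -
  have "r (z - s *\<^sub>R w) < r (z - 0 *\<^sub>R w)"
  proof (rule DERIV_neg_imp_decreasing[OF s(1)])
    fix t assume t: "0 \<le> t" "t \<le> s"
    have "z - t *\<^sub>R w = (1 - t / s) *\<^sub>R z + (t / s) *\<^sub>R (z - s *\<^sub>R w)"
      using s(1) by (simp add: algebra_simps)
    also have "\<dots> \<in> ball a \<rho>"
      using convex_ball z s(2) t s(1) by (intro convexD) auto
    finally have mem: "z - t *\<^sub>R w \<in> ball a \<rho>" .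
    have "((\<lambda>t. z - t *\<^sub>R w) has_derivative (\<lambda>h. - (h *\<^sub>R w))) (at t)"
      by (auto intro!: derivative_eq_intros)
    from has_derivative_compose[OF this deriv[OF mem]]
    have "((\<lambda>t. r (z - t *\<^sub>R w)) has_derivative (\<lambda>h. r' (z - t *\<^sub>R w) (- (h *\<^sub>R w)))) (at t)" .
    then have "((\<lambda>t. r (z - t *\<^sub>R w)) has_real_derivative (- r' (z - t *\<^sub>R w) w)) (at t)"
      by (rule has_derivative_imp_has_field_derivative)
        (simp add: blinfun.minus_right blinfun.scaleR_right)
    then show "\<exists>y. ((\<lambda>t. r (z - t *\<^sub>R w)) has_real_derivative y) (at t) \<and> y < 0"
      using w[OF mem] by (intro exI[of _ "- r' (z - t *\<^sub>R w) w"]) simp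
  qed
  then show ?thesis by simp
qed

text \<open>With \<open>u\<close> and \<open>v\<close> the deviations from 1 at \<open>x\<close> and
  \<open>q\<close>, the derivative in this direction is the real part of
  \<open>(1 + u) / (1 + v)\<close>. Its sign is that of \<open>Re ((1 + u) * cnj (1 + v))\<close>,
  which is at least 1 - 1/4 - 1/4 - 1/16.\<close>

lemma r_descends_\<nu>:
  assumes q: "q \<in> ball a \<rho>" and z: "z \<in> ball a \<rho>"
    and s: "s > 0" "z - s *\<^sub>R (inverse (clin (r' q) \<nu>) *s \<nu>) \<in> ball a \<rho>"
  shows "r (z - s *\<^sub>R (inverse (clin (r' q) \<nu>) *s \<nu>)) < r z"
proof (rule r_descends[OF _ z s])
  fix x assume x: "x \<in> ball a \<rho>"
  define u where "u = clin (r' x) \<nu> - 1"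
  define v where "v = clin (r' q) \<nu> - 1"
  have uv: "cmod u \<le> 1 / 4" "cmod v \<le> 1 / 4" using near_1 x q by (auto simp: u_def v_def)
  have "cmod (u * cnj v) \<le> (1 / 4) * (1 / 4)"
    unfolding norm_mult using uv by (intro mult_mono) auto
  moreover have "\<bar>Re u\<bar> \<le> cmod u" "\<bar>Re v\<bar> \<le> cmod v" "\<bar>Re (u * cnj v)\<bar> \<le> cmod (u * cnj v)"
    by (rule abs_Re_le_cmod)+
  moreover have "Re ((1 + u) * cnj (1 + v)) = 1 + Re u + Re v + Re (u * cnj v)"
    by (simp add: algebra_simps)
  ultimately have "Re ((1 + u) * cnj (1 + v)) > 0" using uv by linarith
  moreover have "1 + v \<noteq> 0" using clin_\<nu>_nz[OF q] by (simp add: v_def)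
  then have "(cmod (1 + v))\<^sup>2 > 0" by simp
  ultimately have "Re ((1 + u) / (1 + v)) > 0"
    unfolding complex_div_cnj[of "1 + u"] Re_divide_of_real by (rule divide_pos_pos)
  then have "Re (clin (r' x) (inverse (clin (r' q) \<nu>) *s \<nu>)) > 0"
    by (simp add: clin_smult u_def v_def divide_inverse mult.commute)
  then show "r' x (inverse (clin (r' q) \<nu>) *s \<nu>) > 0" by simp
qed

text \<open>
  The factor leaves room, in the larger ball, for the shift of a point of the smaller one into the
  tangent hyperplane performed in the proof of \<open>slit\<close>.
\<close>

definition \<rho>' where "\<rho>' = \<rho> / (1 + 3 * M * norm \<nu>)"

lemma \<rho>': "\<rho>' > 0" "ball a \<rho>' \<subseteq> ball a \<rho>" "\<rho>' * (1 + 3 * M * norm \<nu>) = \<rho>"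
proof -
  have *: "0 \<le> 3 * M * norm \<nu>" using M by simp
  then have pos: "1 + 3 * M * norm \<nu> > 0" by linarith
  show "\<rho>' > 0" using \<rho> pos by (simp add: \<rho>'_def)
  show eq: "\<rho>' * (1 + 3 * M * norm \<nu>) = \<rho>" using pos by (simp add: \<rho>'_def)
  have "\<rho>' * 1 \<le> \<rho>' * (1 + 3 * M * norm \<nu>)"
    using \<open>\<rho>' > 0\<close> * by (intro mult_left_mono) auto
  then show "ball a \<rho>' \<subseteq> ball a \<rho>" using eq by auto
qed

text \<open>If the value were a positive number \<open>x\<close>, subtracting \<open>x\<close> times
  the vector normalised at \<open>q\<close> would move \<open>z\<close> into the complex tangent
  hyperplane at \<open>q\<close>. The same move lowers \<open>r\<close> strictly below 0, so it
  would end in \<open>D\<close>, which that hyperplane misses.\<close>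

lemma slit:
  assumes q: "q \<in> frontier D" "q \<in> ball a \<rho>'" and z: "z \<in> closure D" "z \<in> ball a \<rho>'"
  shows "clin (r' q) (z - q) \<notin> of_real ` {0<..}"
proof
  assume "clin (r' q) (z - q) \<in> of_real ` {0<..}"
  then obtain x where x: "x > 0" "clin (r' q) (z - q) = of_real x" by auto
  have qz: "q \<in> ball a \<rho>" "z \<in> ball a \<rho>" using q z \<rho>' by auto
  define \<nu>q where "\<nu>q = inverse (clin (r' q) \<nu>) *s \<nu>"
  have \<nu>q: "clin (r' q) \<nu>q = 1"
    using clin_\<nu>_nz[OF qz(1)] by (simp add: \<nu>q_def clin_smult)
  have "cmod (clin (r' q) \<nu>) \<ge> 3 / 4"
    using near_1[OF qz(1)] norm_triangle_ineq2[of 1 "clin (r' q) \<nu>"]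
    by (simp add: norm_minus_commute)
  then have "inverse (cmod (clin (r' q) \<nu>)) \<le> 4 / 3"
    using le_imp_inverse_le[of "3/4" "cmod (clin (r' q) \<nu>)"] by simp
  then have n\<nu>q: "norm \<nu>q \<le> (4 / 3) * norm \<nu>"
    unfolding \<nu>q_def norm_smult norm_inverse by (intro mult_right_mono) auto
  have "x = cmod (clin (r' q) (z - q))" using x by simp
  also have "\<dots> \<le> M * norm (z - q)" by (rule bound[OF qz(1)])
  also have "norm (z - q) \<le> 2 * \<rho>'"
    using q(2) z(2) dist_triangle[of z q a] by (simp add: dist_commute dist_norm norm_minus_commute)
  finally have "x \<le> M * (2 * \<rho>')" using M by simp
  \<comment> \<open>The factors 2 and 4/3 multiply to 8/3, which the 3 in the definition of
    \<open>\<rho>'\<close> absorbs.\<close>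
  then have "x * norm \<nu>q \<le> (M * (2 * \<rho>')) * ((4 / 3) * norm \<nu>)"
    using n\<nu>q x(1) \<rho>'(1) M by (intro mult_mono) auto
  also have "\<dots> \<le> \<rho>' * (3 * M * norm \<nu>)"
    using \<rho>'(1) M by (simp add: mult_ac)
  finally have "norm (x *\<^sub>R \<nu>q) \<le> \<rho>' * (3 * M * norm \<nu>)" using x(1) by simp
  moreover have "norm (z - a) < \<rho>'" using z(2) by (simp add: dist_norm norm_minus_commute)
  moreover have "norm (z - x *\<^sub>R \<nu>q - a) \<le> norm (z - a) + norm (x *\<^sub>R \<nu>q)"
    using norm_triangle_ineq4[of "z - a" "x *\<^sub>R \<nu>q"] by (simp add: algebra_simps)
  ultimately have "norm (z - x *\<^sub>R \<nu>q - a) < \<rho>"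
    using \<rho>'(3) by (simp add: distrib_left)
  then have mem: "z - x *\<^sub>R \<nu>q \<in> ball a \<rho>" by (simp add: dist_norm norm_minus_commute)
  have "r (z - x *\<^sub>R \<nu>q) < r z"
    using r_descends_\<nu>[OF qz x(1)] mem by (simp add: \<nu>q_def)
  also have "r z \<le> 0" by (rule r_nonpos[OF z(1) qz(2)])
  finally have "z - x *\<^sub>R \<nu>q \<in> D" using D_iff[OF mem] by simp
  moreover have "clin (r' q) (z - x *\<^sub>R \<nu>q - q) = 0"
  proof -
    have "z - x *\<^sub>R \<nu>q - q = (z - q) - x *\<^sub>R \<nu>q" by simp
    then show ?thesis
      using x(2) \<nu>q by (simp only: clin_diff[OF linear_r'] scaleR_eq_smult clin_smult[OF linear_r']) simp
  qed
  from complex_tangent_avoids[OF q(1) qz(1) this] have "z - x *\<^sub>R \<nu>q \<notin> D" by simp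
  ultimately show False by blast
qed

text \<open>Compared with \<open>slit\<close>, the value 0 is excluded as well, since a point of
  \<open>D\<close> cannot lie in the tangent hyperplane.\<close>

lemma slit_interior:
  assumes q: "q \<in> frontier D" "q \<in> ball a \<rho>'" and z: "z \<in> D" "z \<in> ball a \<rho>'"
  shows "clin (r' q) (z - q) \<notin> \<real>\<^sub>\<ge>\<^sub>0"
proof
  assume "clin (r' q) (z - q) \<in> \<real>\<^sub>\<ge>\<^sub>0"
  then obtain x where x: "x \<ge> 0" "clin (r' q) (z - q) = of_real x"
    by (auto elim: nonneg_Reals_cases)
  have "clin (r' q) (z - q) \<noteq> 0"
    using complex_tangent_avoids[OF q(1), of "z - q"] q(2) z(1) \<rho>'(2) by auto
  with x have "clin (r' q) (z - q) \<in> of_real ` {0<..}" by auto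
  then show False using slit[OF q _ z(2)] z(1) closure_subset by blast
qed

lemma holomorphic_on_clin:
  fixes f :: "complex \<Rightarrow> complex ^ 'n"
  assumes "\<And>i. (\<lambda>z. f z $ i) holomorphic_on S"
  shows "(\<lambda>z. clin (r' q) (f z)) holomorphic_on S"
  unfolding clin_eq_sum[OF linear_r', of q "f _"] using assms by (intro holomorphic_intros)

section \<open>From analytic discs to linear discs\<close>

text \<open>The tangent functional along the disc vanishes at 0 and omits the positive reals, so its
  image contains no neighbourhood of 0 and the open mapping theorem makes it identically 0.\<close>

lemma tangent_direction:
  fixes \<phi> \<psi> :: "complex \<Rightarrow> complex ^ 'n"
  assumes \<phi>: "\<And>i. (\<lambda>z. \<phi> z $ i) holomorphic_on ball 0 s" and s: "s > 0"
    and \<psi>: "\<And>i. (\<lambda>z. \<psi> z $ i) holomorphic_on ball 0 s"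
    and eq: "\<And>z. z \<in> ball 0 s \<Longrightarrow> \<phi> z = a + z ^ m *s \<psi> z"
    and near: "\<And>z. z \<in> ball 0 s \<Longrightarrow> \<phi> z \<in> frontier D \<inter> ball a \<rho>'" and m: "m > 0"
  shows "clin (r' a) (\<psi> 0) = 0"
proof -
  define f where "f z = clin (r' a) (\<phi> z - a)" for z
  have hf: "f holomorphic_on ball 0 s"
    unfolding f_def using \<phi> by (intro holomorphic_on_clin) (auto intro!: holomorphic_intros)
  have f0: "f 0 = 0" using eq[of 0] m s by (simp add: f_def clin_0 zero_power)
  have nf: "f z \<notin> of_real ` {0<..}" if "z \<in> ball 0 s" for z
    unfolding f_def using near[OF that] a \<rho>'(1)
    by (intro slit) (auto simp: frontier_def)
  have "f constant_on ball 0 s"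
  proof (rule ccontr)
    assume nc: "\<not> f constant_on ball 0 s"
    have "open (f ` ball 0 s)"
      by (rule open_mapping_thm[OF hf _ _ _ order_refl nc]) auto
    moreover have "0 \<in> f ` ball 0 s" using f0 s by (metis centre_in_ball imageI)
    ultimately obtain e where e: "e > 0" "ball 0 e \<subseteq> f ` ball 0 s"
      using open_contains_ball by blast
    have "of_real (e / 2) \<in> ball (0::complex) e" using e(1) by simp
    then have "of_real (e / 2) \<in> f ` ball 0 s" using e(2) by blast
    moreover have "complex_of_real (e / 2) \<in> of_real ` {0<..}" using e(1) by (intro imageI) simp
    ultimately show False using nf by (metis imageE)
  qed
  then have fz: "f z = 0" if "z \<in> ball 0 s" for z
    using f0 s that unfolding constant_on_def by (metis centre_in_ball)
  define g where "g z = clin (r' a) (\<psi> z)" for z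
  \<comment> \<open>Dividing by \<open>z ^ m\<close> works only away from 0; the value at 0 follows
    by continuity.\<close>
  have gz: "g z = 0" if "z \<in> ball 0 s" "z \<noteq> 0" for z
    using fz[OF that(1)] eq[OF that(1)] that(2) by (simp add: f_def g_def clin_smult)
  have "g holomorphic_on ball 0 s" unfolding g_def by (intro holomorphic_on_clin \<psi>)
  then have "isCont g 0"
    using s by (meson centre_in_ball continuous_on_eq_continuous_at holomorphic_on_imp_continuous_on open_ball)
  then have "(g \<longlongrightarrow> g 0) (at 0)" by (simp add: continuous_within)
  moreover have "\<forall>\<^sub>F z in at 0. z \<in> ball 0 s"
    using s by (intro eventually_at_in_open') auto
  then have "\<forall>\<^sub>F z in at 0. g z = 0"
    using eventually_neq_at_within by eventually_elim (use gz in auto)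
  then have "(g \<longlongrightarrow> 0) (at 0)" by (rule tendsto_eventually)
  ultimately have "g 0 = 0" by (rule tendsto_unique[rotated 1]) simp
  then show ?thesis by (simp add: g_def)
qed

text \<open>If the claim fails, the connected disc of points \<open>p + u *s \<psi> 0\<close> meets
  the boundary at some \<open>q\<close>. For \<open>f\<close> the tangent functional at
  \<open>q\<close> along the disc, \<open>f 0 = - u * L\<close> and
  \<open>f z = f 0 + z ^ m * g z\<close> with \<open>g 0 = L\<close>. Harnack bounds
  \<open>f\<close> by \<open>9 * cmod (f 0)\<close> on the circle of radius \<open>s / 2\<close>, so
  \<open>z ^ m * g z\<close> is bounded there by 10 times \<open>cmod (f 0)\<close>, and comparing
  with \<open>L\<close> bounds \<open>cmod u\<close> from below. The bound depends only on
  \<open>s\<close> and \<open>m\<close>, not on \<open>p\<close>.\<close>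

lemma pushed_disc:
  fixes \<phi> \<psi> :: "complex \<Rightarrow> complex ^ 'n"
  assumes \<phi>: "\<And>i. (\<lambda>z. \<phi> z $ i) holomorphic_on ball 0 s" and s: "s > 0"
    and \<psi>: "\<And>i. (\<lambda>z. \<psi> z $ i) holomorphic_on ball 0 s"
    and eq: "\<And>z. z \<in> ball 0 s \<Longrightarrow> \<phi> z = p + z ^ m *s \<psi> z" and m: "m > 0"
    and near: "\<And>z. z \<in> ball 0 s \<Longrightarrow> \<phi> z \<in> D \<inter> ball a \<rho>'"
    and t: "cmod t < (s / 2) ^ m / 10"
    and tp: "\<And>u. cmod u \<le> cmod t \<Longrightarrow> p + u *s \<psi> 0 \<in> ball a \<rho>'"
  shows "p + t *s \<psi> 0 \<in> D"
proof (rule ccontr)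
  assume nD: "p + t *s \<psi> 0 \<notin> D"
  define S where "S = (\<lambda>u. p + u *s \<psi> 0) ` cball 0 (cmod t)"
  have "p = \<phi> 0" using eq[of 0] s m by (simp add: zero_power)
  then have pD: "p \<in> D" using near s by simp
  have "connected S"
    unfolding S_def by (intro connected_continuous_image continuous_intros) auto
  moreover have "p \<in> S" unfolding S_def by (rule image_eqI[of _ _ 0]) auto
  moreover have "p + t *s \<psi> 0 \<in> S" unfolding S_def by (rule image_eqI[of _ _ t]) auto
  ultimately have "S \<inter> frontier D \<noteq> {}"
    using pD nD by (intro connected_Int_frontier) auto
  then obtain u where u: "cmod u \<le> cmod t" and q: "p + u *s \<psi> 0 \<in> frontier D"
    by (auto simp: S_def)
  define q where "q = p + u *s \<psi> 0"
  have q: "q \<in> frontier D" "q \<in> ball a \<rho>'" using q tp[OF u] by (auto simp: q_def)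
  define f where "f z = clin (r' q) (\<phi> z - q)" for z
  have hf: "f holomorphic_on ball 0 s"
    unfolding f_def using \<phi> by (intro holomorphic_on_clin) (auto intro!: holomorphic_intros)
  have sl: "f z \<notin> \<real>\<^sub>\<ge>\<^sub>0" if "z \<in> ball 0 s" for z
    unfolding f_def using near[OF that] by (intro slit_interior q) auto
  define L where "L = clin (r' q) (\<psi> 0)"
  have f0: "f 0 = - u * L"
  proof -
    have "\<phi> 0 - q = (- u) *s \<psi> 0"
      unfolding q_def \<open>p = \<phi> 0\<close> by (simp add: vec_eq_iff)
    then show ?thesis by (simp only: f_def L_def clin_smult[OF linear_r'])
  qed
  \<comment> \<open>The slit contains 0, so \<open>f 0\<close> is nonzero; this is what allows
    \<open>L\<close> to be cancelled at the end.\<close>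
  have "f 0 \<noteq> 0" using sl[of 0] s by auto
  then have L: "L \<noteq> 0" using f0 by auto
  define g where "g z = clin (r' q) (\<psi> z)" for z
  have hg: "g holomorphic_on ball 0 s" unfolding g_def by (intro holomorphic_on_clin \<psi>)
  have fg: "f z = f 0 + z ^ m * g z" if "z \<in> ball 0 s" for z
  proof -
    have "\<phi> z - q = (\<phi> 0 - q) + z ^ m *s \<psi> z" using eq[OF that] \<open>p = \<phi> 0\<close> by simp
    then show ?thesis by (simp only: f_def g_def clin_add[OF linear_r'] clin_smult[OF linear_r'])
  qed
  define h where "h = (s / 2) ^ m"
  have h: "h > 0" using s by (simp add: h_def)
  have gB: "cmod (g z) \<le> 10 * cmod (f 0) / h" if z: "cmod (0 - z) = s / 2" for z
  proof -
    have "z \<in> ball 0 s" using z s by simp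
    from fg[OF this] have "cmod (z ^ m * g z) = cmod (f z - f 0)" by simp
    then have "cmod (z ^ m * g z) \<le> cmod (f z) + cmod (f 0)"
      using norm_triangle_ineq4[of "f z" "f 0"] by simp
    moreover have "cmod (f z) \<le> 9 * cmod (f 0)"
      using z by (intro slit_plane_harnack[OF s hf sl]) auto
    moreover have "cmod (z ^ m * g z) = h * cmod (g z)"
      using z by (simp only: norm_mult norm_power h_def diff_0 norm_minus_cancel)
    ultimately have "h * cmod (g z) \<le> 10 * cmod (f 0)" by linarith
    then show ?thesis using h by (simp add: pos_le_divide_eq mult.commute)
  qed
  \<comment> \<open>The Cauchy inequality of order 0 carries the bound for \<open>g\<close> from the
    circle to its centre.\<close>
  have "cmod ((deriv ^^ 0) g 0) \<le> fact 0 * (10 * cmod (f 0) / h) / (s / 2) ^ 0"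
  proof (rule Cauchy_inequality)
    show "g holomorphic_on ball 0 (s / 2)" using hg s by (auto elim: holomorphic_on_subset)
    show "continuous_on (cball 0 (s / 2)) g"
      using hg s by (intro holomorphic_on_imp_continuous_on) (auto elim: holomorphic_on_subset)
  qed (use s gB in auto)
  then have "cmod L \<le> 10 * (cmod u * cmod L) / h" by (simp add: g_def L_def f0 norm_mult)
  then have "cmod L * h \<le> cmod L * (10 * cmod u)" using h by (simp add: field_simps)
  then have "h \<le> 10 * cmod u" using L by simp
  with u t show False by (simp add: h_def)
qed

text \<open>Each small push along the inward transversal vector gives a linear disc inside
  \<open>D\<close> whose radius \<open>c\<close> does not depend on the size of the push, so the
  radius survives in the limit.\<close>

lemma linear_disc_from_analytic_disc:
  assumes "nontrivial_analytic_disc (frontier D) a \<phi>"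
  shows "\<exists>X\<in>L_set D a. X \<noteq> 0"
proof -
  have \<phi>: "\<And>i. (\<lambda>z. \<phi> z $ i) holomorphic_on ball 0 1" and nc: "\<not> \<phi> constant_on ball 0 1"
    and fr: "\<phi> ` ball 0 1 \<subseteq> frontier D" and \<phi>0: "\<phi> 0 = a"
    using assms by (auto simp: nontrivial_analytic_disc_def)
  obtain \<psi> :: "complex \<Rightarrow> complex ^ 'n" and m :: nat and s1 where s1: "0 < s1" "s1 \<le> 1" and m: "0 < m"
    and \<psi>: "\<And>i. (\<lambda>z. \<psi> z $ i) holomorphic_on ball 0 s1"
    and eq: "\<And>z. z \<in> ball 0 s1 \<Longrightarrow> \<phi> z = a + z ^ m *s \<psi> z" and \<psi>0: "\<psi> 0 \<noteq> 0"
    using holomorphic_vector_factor[OF \<phi> zero_less_one nc] unfolding \<phi>0 by metis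
  have "continuous_on (ball 0 1) (\<lambda>z. \<chi> i. \<phi> z $ i)"
    using \<phi> by (intro continuous_intros holomorphic_on_imp_continuous_on)
  then have "isCont \<phi> 0" by (simp add: continuous_on_eq_continuous_at)
  \<comment> \<open>Half of \<open>\<rho>'\<close> is kept in reserve so that the pushed disc stays
    in the ball.\<close>
  then obtain s2 where s2: "s2 > 0" "\<And>z. dist z 0 < s2 \<Longrightarrow> dist (\<phi> z) a < \<rho>' / 2"
    unfolding continuous_at_eps_delta \<phi>0 using \<rho>'(1) half_gt_zero by blast
  define s where "s = min s1 s2"
  have s: "s > 0" "ball (0::complex) s \<subseteq> ball 0 s1" "ball (0::complex) s \<subseteq> ball 0 1"
    using s1 s2 by (auto simp: s_def)
  have \<phi>s: "(\<lambda>z. \<phi> z $ i) holomorphic_on ball 0 s" for i using \<phi> s(3) by (rule holomorphic_on_subset)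
  have \<psi>s: "(\<lambda>z. \<psi> z $ i) holomorphic_on ball 0 s" for i using \<psi> s(2) by (rule holomorphic_on_subset)
  have eqs: "\<phi> z = a + z ^ m *s \<psi> z" if "z \<in> ball 0 s" for z using that s eq by blast
  have frs: "\<phi> z \<in> frontier D" if "z \<in> ball 0 s" for z using that s fr by blast
  have near: "norm (\<phi> z - a) < \<rho>' / 2" if "z \<in> ball 0 s" for z
    using s2(2)[of z] that by (simp add: s_def dist_norm norm_minus_commute)
  define X where "X = \<psi> 0"
  have tan: "clin (r' a) X = 0"
    unfolding X_def
  proof (rule tangent_direction[OF \<phi>s s(1) \<psi>s eqs _ m])
    show "\<phi> z \<in> frontier D \<inter> ball a \<rho>'" if "z \<in> ball 0 s" for z
      using frs[OF that] near[OF that] \<rho>'(1) by (simp add: dist_norm norm_minus_commute)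
  qed
  \<comment> \<open>The first term is the radius granted by \<open>pushed_disc\<close>; the second
    keeps \<open>u *s X\<close> shorter than \<open>\<rho>' / 2\<close>.\<close>
  define c where "c = min ((s / 2) ^ m / 10) (\<rho>' / (2 * (norm X + 1)))"
  have nX: "norm X + 1 > 0" by (simp add: add_nonneg_pos)
  have c: "c > 0" using s \<rho>'(1) nX by (simp add: c_def)
  define \<nu>a where "\<nu>a = inverse (clin (r' a) \<nu>) *s \<nu>"
  have in_D: "a - \<epsilon> *\<^sub>R \<nu>a + t *s X \<in> D" if \<epsilon>: "\<epsilon> > 0" "\<epsilon> * norm \<nu>a < \<rho>' / 4" and t: "cmod t < c" for \<epsilon> t
  proof -
    define p where "p = a - \<epsilon> *\<^sub>R \<nu>a"
    define \<phi>' :: "complex \<Rightarrow> complex ^ 'n" where "\<phi>' z = \<phi> z - \<epsilon> *\<^sub>R \<nu>a" for z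
    have "p + t *s \<psi> 0 \<in> D"
    proof (rule pushed_disc[OF _ s(1) \<psi>s _ m])
      show "(\<lambda>z. \<phi>' z $ i) holomorphic_on ball 0 s" for i
        unfolding \<phi>'_def vector_minus_component by (intro holomorphic_intros \<phi>s)
      show "\<phi>' z = p + z ^ m *s \<psi> z" if "z \<in> ball 0 s" for z
        using eqs[OF that] by (simp add: \<phi>'_def p_def)
      show "\<phi>' z \<in> D \<inter> ball a \<rho>'" if z: "z \<in> ball 0 s" for z
      proof -
        have "norm (\<phi>' z - a) \<le> norm (\<phi> z - a) + norm (\<epsilon> *\<^sub>R \<nu>a)"
          using norm_triangle_ineq4[of "\<phi> z - a" "\<epsilon> *\<^sub>R \<nu>a"] by (simp add: \<phi>'_def algebra_simps)
        also have "\<dots> < \<rho>'" using near[OF z] \<epsilon> \<rho>'(1) by simp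
        finally have mem: "\<phi>' z \<in> ball a \<rho>'" by (simp add: dist_norm norm_minus_commute)
        have mz: "\<phi> z \<in> ball a \<rho>"
          using near[OF z] \<rho>'(1,2) by (intro subsetD[OF \<rho>'(2)]) (simp add: dist_norm norm_minus_commute)
        have "r (\<phi>' z) < r (\<phi> z)"
          unfolding \<phi>'_def \<nu>a_def
          using mem \<rho>'(2) \<rho> mz \<epsilon>(1) by (intro r_descends_\<nu>) (auto simp: \<phi>'_def \<nu>a_def)
        also have "r (\<phi> z) = 0" by (rule r_frontier(1)[OF frs[OF z] mz])
        finally show ?thesis using mem D_iff \<rho>'(2) by auto
      qed
      show "cmod t < (s / 2) ^ m / 10" using t by (simp add: c_def)
      show "p + u *s \<psi> 0 \<in> ball a \<rho>'" if u: "cmod u \<le> cmod t" for u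
      proof -
        have "cmod u < \<rho>' / (2 * (norm X + 1))" using u t by (simp add: c_def)
        then have "cmod u * (2 * (norm X + 1)) < \<rho>'" using nX by (simp add: pos_less_divide_eq)
        then have "cmod u * norm X + cmod u < \<rho>' / 2" by (simp add: algebra_simps)
        then have "norm (u *s X) < \<rho>' / 2" using norm_ge_zero[of u] unfolding norm_smult by linarith
        moreover have "norm (\<epsilon> *\<^sub>R \<nu>a) < \<rho>' / 2" using \<epsilon> \<rho>'(1) by simp
        ultimately have "norm (u *s X - \<epsilon> *\<^sub>R \<nu>a) < \<rho>'"
          using norm_triangle_ineq4[of "u *s X" "\<epsilon> *\<^sub>R \<nu>a"] by simp
        then show ?thesis by (simp add: p_def X_def dist_norm norm_minus_commute algebra_simps)
      qed
    qed
    then show ?thesis by (simp add: p_def X_def)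
  qed
  have "a + t *s X \<in> frontier D" if t: "cmod t < c" for t
  proof -
    \<comment> \<open>Adding 1 makes \<open>e * norm \<nu>a\<close> strictly smaller than
      \<open>\<rho>' / 4\<close>, as \<open>in_D\<close> requires; the pushes
      \<open>e / Suc k\<close> then tend to 0.\<close>
    define N where "N = norm \<nu>a + 1"
    define e where "e = \<rho>' / (4 * N)"
    have N: "N > 0" by (simp add: N_def add_nonneg_pos)
    have e: "e > 0" using \<rho>'(1) N by (simp add: e_def)
    have ee: "e * N = \<rho>' / 4" using N by (simp add: e_def)
    have "a - (e / Suc k) *\<^sub>R \<nu>a + t *s X \<in> D" for k :: nat
    proof (rule in_D[OF _ _ t])
      show "e / Suc k > 0" using e by simp
      have "e / Suc k \<le> e" using e by (simp add: field_simps)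
      then have "e / Suc k * norm \<nu>a \<le> e * norm \<nu>a" by (intro mult_right_mono) auto
      moreover have "e * norm \<nu>a + e = \<rho>' / 4" using ee by (simp add: N_def distrib_left)
      ultimately show "e / Suc k * norm \<nu>a < \<rho>' / 4" using e by linarith
    qed
    moreover have "(\<lambda>k. a - (e / Suc k) *\<^sub>R \<nu>a + t *s X) \<longlonglongrightarrow> a - 0 *\<^sub>R \<nu>a + t *s X"
      by (intro tendsto_intros LIMSEQ_Suc lim_const_over_n)
    ultimately have "a + t *s X \<in> closure D"
      unfolding closure_sequential by (intro exI[of _ "\<lambda>k. a - (e / Suc k) *\<^sub>R \<nu>a + t *s X"]) simp
    \<comment> \<open>The whole line in the direction \<open>X\<close> lies in the complex tangent
      hyperplane at \<open>a\<close>, so the limit disc cannot enter \<open>D\<close>.\<close>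
    moreover have "a + t *s X \<notin> D"
      using a \<rho> tan by (intro complex_tangent_avoids) (auto simp: clin_smult)
    ultimately show ?thesis using open_D by (simp add: frontier_def interior_open)
  qed
  then have "X \<in> L_set D a" using c unfolding L_set_def by blast
  then show ?thesis using \<psi>0 X_def by blast
qed

end

section \<open>Linear discs as analytic discs, and the equivalence\<close>

theorem proposition7:
  fixes D :: "(complex ^ 'n) set" and a :: "complex ^ 'n"
  assumes "C_convex D"
    and "C1_smooth_boundary_point D a"
  shows "(\<nexists>\<phi>. nontrivial_analytic_disc (frontier D) a \<phi>) \<longleftrightarrow> L_set D a = {0}"
proof -
  obtain r r' \<nu> \<rho> M where "boundary_chart D a r r' \<nu> \<rho> M"
    by (rule boundary_chart_exists[OF assms])
  then interpret boundary_chart D a r r' \<nu> \<rho> M .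
  have 0: "0 \<in> L_set D a" using a by (auto simp: L_set_def intro: exI[of _ 1])
  \<comment> \<open>The elementary direction: a linear disc of radius \<open>e\<close>, rescaled to
    the unit disc, is itself an analytic disc.\<close>
  have "\<exists>\<phi>. nontrivial_analytic_disc (frontier D) a \<phi>" if X: "X \<in> L_set D a" "X \<noteq> 0" for X
  proof -
    obtain e where e: "e > 0" "\<And>t. cmod t < e \<Longrightarrow> a + t *s X \<in> frontier D"
      using X(1) by (auto simp: L_set_def)
    define \<phi> where "\<phi> z = a + (of_real e * z) *s X" for z
    have "\<phi> 0 \<noteq> \<phi> (1 / 2)" using e(1) X(2) by (simp add: \<phi>_def)
    moreover have "0 \<in> ball (0::complex) 1" "1 / 2 \<in> ball (0::complex) 1"
      by (auto simp: norm_divide)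
    ultimately have "\<not> \<phi> constant_on ball 0 1"
      unfolding constant_on_def by metis
    moreover have "\<phi> ` ball 0 1 \<subseteq> frontier D"
      using e by (auto simp: \<phi>_def norm_mult)
    moreover have "(\<lambda>z. \<phi> z $ i) holomorphic_on ball 0 1" for i
      unfolding \<phi>_def by (simp, intro holomorphic_intros)
    ultimately show ?thesis
      unfolding nontrivial_analytic_disc_def by (intro exI[of _ \<phi>]) (auto simp: \<phi>_def)
  qed
  then show ?thesis using 0 linear_disc_from_analytic_disc by blast
qed

end
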